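(* Let $\mathcal{X}=\{1,\dots,n\}$, let $\pi$ be a probability measure on $\mathcal{X}$ with strictly positive masses, let $\mathcal{X}=\bigsqcup_{i=1}^k\mathcal{O}_i$ be a partition into $k$ non-empty sets, and let $G$ be the associated Gibbs kernel. If $P\in\mathcal{L}(\pi)$, then $$\|GP-\Pi\|_{F,\pi}^2\le k-1=\mathcal{O}(k),\qquad\|GPG-\Pi\|_{F,\pi}^2\le k-1=\mathcal{O}(k).$$ In particular, when $k=2$, $\|GP-\Pi\|_{F,\pi}^2\le1=\mathcal{O}(1)$ and $\|GPG-\Pi\|_{F,\pi}^2\le1=\mathcal{O}(1)$. In contrast, if $P\in\mathcal{S}(\pi)$ and $P$ is lazy, then $$\|P-\Pi\|_{F,\pi}^2\ge\frac n4-1=\Omega(n).$$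
   Context: $\mathcal{S}(\pi)$ is the set of transition matrices $P$ on $\mathcal{X}$ with $\pi P=\pi$, and $\mathcal{L}(\pi)$ the set of those that are $\pi$-reversible. $P$ is lazy if $P(x,x)\ge1/2$ for all $x$. The Gibbs kernel is $G(x,y)=\pi(y)/\pi(\mathcal{O}(x))$ if $y\in\mathcal{O}(x)$ and $0$ otherwise, where $\mathcal{O}(x)$ is the block containing $x$ and $\pi(A)=\sum_{z\in A}\pi(z)$. $\Pi$ is the matrix all of whose rows equal $\pi$. $\|M\|_{F,\pi}^2=\mathrm{Tr}(M^*M)$ with $M^*(x,y)=\frac{\pi(y)}{\pi(x)}M(y,x)$. The symbols $\mathcal{O}(\cdot)$ and $\Omega(\cdot)$ on right-hand sides are the usual asymptotic order notations (upper and lower bounds up to positive constants for large argument), applied to the explicit bounds. *)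

theory Defs
  imports "HOL-Analysis.Analysis" "HOL-Library.Landau_Symbols" "HOL-Library.Disjoint_Sets"
begin

text \<open>
  The state space with \<open>n\<close> points is a type \<open>'n\<close> of class \<open>finite\<close>, with \<open>n = CARD('n)\<close>.
  The entry \<open>M(x,y)\<close> of a matrix is \<open>M $ x $ y\<close>.
\<close>

definition positive_prob :: "real ^ 'n \<Rightarrow> bool"
  where "positive_prob \<pi> \<longleftrightarrow> (\<forall>x. \<pi> $ x > 0) \<and> (\<Sum>x\<in>UNIV. \<pi> $ x) = 1"

definition transition_matrix :: "real ^ 'n ^ 'n \<Rightarrow> bool"
  where "transition_matrix P \<longleftrightarrow> (\<forall>x y. P $ x $ y \<ge> 0) \<and> (\<forall>x. (\<Sum>y\<in>UNIV. P $ x $ y) = 1)"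

definition stationary_kernels :: "real ^ 'n \<Rightarrow> (real ^ 'n ^ 'n) set"
  where "stationary_kernels \<pi> = {P. transition_matrix P \<and> \<pi> v* P = \<pi>}"

definition reversible_kernels :: "real ^ 'n \<Rightarrow> (real ^ 'n ^ 'n) set"
  where "reversible_kernels \<pi> =
    {P \<in> stationary_kernels \<pi>. \<forall>x y. \<pi> $ x * P $ x $ y = \<pi> $ y * P $ y $ x}"

definition lazy :: "real ^ 'n ^ 'n \<Rightarrow> bool"
  where "lazy P \<longleftrightarrow> (\<forall>x. P $ x $ x \<ge> 1 / 2)"

text \<open>Meaningful only when exactly one member of \<open>\<O>\<close> contains \<open>x\<close>, as for a partition.\<close>

definition block :: "'n set set \<Rightarrow> 'n \<Rightarrow> 'n set"
  where "block \<O> x = (THE B. B \<in> \<O> \<and> x \<in> B)"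

definition gibbs :: "real ^ 'n \<Rightarrow> 'n set set \<Rightarrow> real ^ 'n ^ 'n"
  where "gibbs \<pi> \<O> =
    (\<chi> x y. if y \<in> block \<O> x then \<pi> $ y / (\<Sum>z\<in>block \<O> x. \<pi> $ z) else 0)"

definition stationary_matrix :: "real ^ 'n \<Rightarrow> real ^ 'n ^ 'n"
  where "stationary_matrix \<pi> = (\<chi> x y. \<pi> $ y)"

definition adjoint_wrt :: "real ^ 'n \<Rightarrow> real ^ 'n ^ 'n \<Rightarrow> real ^ 'n ^ 'n"
  where "adjoint_wrt \<pi> M = (\<chi> x y. \<pi> $ y / \<pi> $ x * M $ y $ x)"

definition frobenius_norm :: "real ^ 'n \<Rightarrow> real ^ 'n ^ 'n \<Rightarrow> real"
  where "frobenius_norm \<pi> M = sqrt (trace (adjoint_wrt \<pi> M ** M))"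

end

theory Submission
  imports Defs "HOL-Real_Asymp.Real_Asymp"
begin

text \<open>
  For a \<open>\<pi>\<close>-stationary kernel \<open>M\<close> one has \<open>\<parallel>M - \<Pi>\<parallel>\<^sup>2 = \<parallel>M\<parallel>\<^sup>2 - 1\<close>, where
  \<open>\<parallel>M\<parallel>\<^sup>2 = \<Sum>\<^sub>y\<^sub>,\<^sub>x \<pi>(y) M(y,x)\<^sup>2 / \<pi>(x)\<close>. For the lower bound, only the diagonal terms \<open>P(x,x)\<^sup>2\<close> are kept.
  For the upper bound, if \<open>K\<close> is \<open>\<pi>\<close>-stationary, then \<open>(GK)(y,x) \<le> \<pi>(x) / \<pi>(\<O>(y)) = \<pi>(x) G(y,y) / \<pi>(y)\<close>, so
  \<open>\<parallel>GK\<parallel>\<^sup>2 \<le> \<Sum>\<^sub>y G(y,y) \<Sum>\<^sub>x (GK)(y,x) = Tr G = k\<close>; this is used with \<open>K = P\<close> and \<open>K = PG\<close>.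
\<close>

lemma stationary_kernelsI:
  assumes "\<And>x y. P $ x $ y \<ge> 0" "\<And>x. (\<Sum>y\<in>UNIV. P $ x $ y) = 1"
    and "\<And>y. (\<Sum>x\<in>UNIV. \<pi> $ x * P $ x $ y) = \<pi> $ y"
  shows "P \<in> stationary_kernels \<pi>"
  using assms
  by (simp add: stationary_kernels_def transition_matrix_def vec_eq_iff vector_matrix_mult_def mult.commute)

lemma stationary_kernelsD:
  assumes "P \<in> stationary_kernels \<pi>"
  shows "P $ x $ y \<ge> 0" "(\<Sum>y\<in>UNIV. P $ x $ y) = 1"
    and "(\<Sum>x\<in>UNIV. \<pi> $ x * P $ x $ y) = \<pi> $ y"
  using assms
  by (simp_all add: stationary_kernels_def transition_matrix_def vec_eq_iff vector_matrix_mult_def mult.commute)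

text \<open>Closure under products is what makes GP and GPG kernels to which the norm identity
  applies. Row sums factor after exchanging the two sums, and the law is preserved by letting the
  factors act on \<pi> one after the other.\<close>

lemma stationary_kernels_mult:
  assumes "P \<in> stationary_kernels \<pi>" "Q \<in> stationary_kernels \<pi>"
  shows "P ** Q \<in> stationary_kernels \<pi>"
proof (rule stationary_kernelsI)
  show "(P ** Q) $ x $ y \<ge> 0" for x y
    using assms by (simp add: matrix_matrix_mult_def sum_nonneg stationary_kernelsD(1))
  fix x
  have "(\<Sum>y\<in>UNIV. (P ** Q) $ x $ y) = (\<Sum>z\<in>UNIV. P $ x $ z * (\<Sum>y\<in>UNIV. Q $ z $ y))"
    by (simp add: matrix_matrix_mult_def sum_distrib_left) (rule sum.swap)
  then show "(\<Sum>y\<in>UNIV. (P ** Q) $ x $ y) = 1"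
    using assms by (simp add: stationary_kernelsD(2))
next
  fix y
  have "\<pi> v* (P ** Q) = \<pi>"
    using assms by (simp add: stationary_kernels_def flip: vector_matrix_mul_assoc)
  then have "(\<pi> v* (P ** Q)) $ y = \<pi> $ y"
    by simp
  then show "(\<Sum>x\<in>UNIV. \<pi> $ x * (P ** Q) $ x $ y) = \<pi> $ y"
    by (simp add: vector_matrix_mult_def mult.commute)
qed

lemma frobenius_norm_squared:
  assumes "\<And>x. \<pi> $ x > 0"
  shows "(frobenius_norm \<pi> M)\<^sup>2 = (\<Sum>y\<in>UNIV. \<Sum>x\<in>UNIV. \<pi> $ y / \<pi> $ x * (M $ y $ x)\<^sup>2)"
proof -
  have "trace (adjoint_wrt \<pi> M ** M) = (\<Sum>x\<in>UNIV. \<Sum>y\<in>UNIV. \<pi> $ y / \<pi> $ x * (M $ y $ x)\<^sup>2)"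
    by (simp add: trace_def adjoint_wrt_def matrix_matrix_mult_def power2_eq_square mult.assoc)
  also have "\<dots> = (\<Sum>y\<in>UNIV. \<Sum>x\<in>UNIV. \<pi> $ y / \<pi> $ x * (M $ y $ x)\<^sup>2)"
    by (rule sum.swap)
  \<comment> \<open>In HOL the square of \<open>sqrt t\<close> is the absolute value of
    \<open>t\<close>; nonnegativity of the trace removes it.\<close>
  moreover have "\<dots> \<ge> 0"
    using assms by (intro sum_nonneg) (simp add: less_imp_le)
  ultimately show ?thesis
    by (simp add: frobenius_norm_def)
qed

text \<open>A Pythagoras identity: in the weighted inner product, both the pairing of M with \<Pi>
  and the squared norm of \<Pi> equal 1. The weight \<pi>(y)/\<pi>(x) cancels the entry \<pi>(x) of
  \<Pi> in the cross term, leaving the sum of \<pi>(y) M(y,x), which row sums evaluate.\<close>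

lemma frobenius_norm_diff_stationary_matrix:
  assumes "positive_prob \<pi>" "M \<in> stationary_kernels \<pi>"
  shows "(frobenius_norm \<pi> (M - stationary_matrix \<pi>))\<^sup>2
    = (\<Sum>y\<in>UNIV. \<Sum>x\<in>UNIV. \<pi> $ y / \<pi> $ x * (M $ y $ x)\<^sup>2) - 1"
proof -
  have pos: "\<pi> $ x > 0" for x
    using assms(1) by (simp add: positive_prob_def)
  have total: "(\<Sum>x\<in>UNIV. \<pi> $ x) = 1"
    using assms(1) by (simp add: positive_prob_def)
  have nz: "\<pi> $ x \<noteq> 0" for x
    using pos[of x] by simp
  have "\<pi> $ y / \<pi> $ x * ((M - stationary_matrix \<pi>) $ y $ x)\<^sup>2
      = \<pi> $ y / \<pi> $ x * (M $ y $ x)\<^sup>2 - 2 * (\<pi> $ y * M $ y $ x) + \<pi> $ y * \<pi> $ x" for x y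
    using nz[of x] by (simp add: stationary_matrix_def power2_eq_square field_simps)
  moreover have "(\<Sum>y\<in>UNIV. \<Sum>x\<in>UNIV. \<pi> $ y * M $ y $ x) = 1"
    using assms(2) total by (simp add: stationary_kernelsD(2) flip: sum_distrib_left)
  moreover have "(\<Sum>y\<in>UNIV. \<Sum>x\<in>UNIV. \<pi> $ y * \<pi> $ x) = 1"
    using total by (simp flip: sum_distrib_left)
  ultimately show ?thesis
    by (simp add: frobenius_norm_squared[OF pos] sum.distrib sum_subtractf flip: sum_distrib_left)
qed

text \<open>Disjointness gives the uniqueness behind \<open>THE\<close>; no later proof unfolds
  \<open>block\<close>.\<close>

lemma block_eq:
  assumes "partition_on UNIV \<O>" "B \<in> \<O>" "x \<in> B"
  shows "block \<O> x = B"
  unfolding block_def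
proof (rule the_equality)
  fix C assume "C \<in> \<O> \<and> x \<in> C"
  then show "C = B"
    using partition_onD2[OF assms(1)] assms(2,3) by (auto simp: disjoint_def)
qed (use assms in auto)

lemma block_partition:
  assumes "partition_on UNIV \<O>"
  shows "block \<O> x \<in> \<O>" "x \<in> block \<O> x"
proof -
  obtain B where "B \<in> \<O>" "x \<in> B"
    using partition_onD1[OF assms] by auto
  then show "block \<O> x \<in> \<O>" "x \<in> block \<O> x"
    using block_eq[OF assms] by simp_all
qed

lemma block_sym:
  assumes "partition_on UNIV \<O>" "y \<in> block \<O> x"
  shows "block \<O> y = block \<O> x"
  using assms by (intro block_eq) (simp_all add: block_partition)

lemma block_measure_pos:
  assumes "\<And>x. \<pi> $ x > (0::real)" "partition_on UNIV \<O>"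
  shows "(\<Sum>z\<in>block \<O> x. \<pi> $ z) > 0"
  using assms block_partition(2)[OF assms(2), of x] by (intro sum_pos) auto

text \<open>Within a block, \<pi>(x) G(x,y) is \<pi>(x) \<pi>(y) divided by the mass of the common
  block, which is symmetric in x and y. This detailed balance turns the column sum at y into
  \<pi>(y) times a row sum.\<close>

lemma gibbs_stationary:
  assumes "positive_prob \<pi>" "partition_on UNIV \<O>"
  shows "gibbs \<pi> \<O> \<in> stationary_kernels \<pi>"
proof -
  have pos: "\<pi> $ x > 0" for x
    using assms(1) by (simp add: positive_prob_def)
  note bpos = block_measure_pos[of \<pi>, OF pos assms(2)]
  have row: "(\<Sum>y\<in>UNIV. gibbs \<pi> \<O> $ x $ y) = 1" for x
    using bpos[of x] by (simp add: gibbs_def flip: sum.inter_restrict sum_divide_distrib)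
  have rev: "\<pi> $ x * gibbs \<pi> \<O> $ x $ y = \<pi> $ y * gibbs \<pi> \<O> $ y $ x" for x y
  proof -
    have "y \<in> block \<O> x \<longleftrightarrow> x \<in> block \<O> y"
      using block_sym[OF assms(2)] block_partition(2)[OF assms(2)] by metis
    then show ?thesis
      using block_sym[OF assms(2), of y x] by (auto simp: gibbs_def)
  qed
  show ?thesis
  proof (rule stationary_kernelsI)
    show "gibbs \<pi> \<O> $ x $ y \<ge> 0" for x y
      using pos by (simp add: gibbs_def sum_nonneg less_imp_le)
    show "(\<Sum>x\<in>UNIV. \<pi> $ x * gibbs \<pi> \<O> $ x $ y) = \<pi> $ y" for y
      by (simp add: rev[of _ y] row flip: sum_distrib_left)
  qed (rule row)
qed

text \<open>The summands are the diagonal entries of the Gibbs kernel, so this computes its trace: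
  each block contributes its mass divided by itself.\<close>

lemma sum_divide_block_measure:
  assumes "\<And>x. \<pi> $ x > 0" "partition_on UNIV \<O>"
  shows "(\<Sum>y\<in>UNIV. \<pi> $ y / (\<Sum>z\<in>block \<O> y. \<pi> $ z)) = real (card \<O>)"
proof -
  let ?g = "\<lambda>y. \<pi> $ y / (\<Sum>z\<in>block \<O> y. \<pi> $ z)"
  have "(\<Sum>y\<in>UNIV. ?g y) = (\<Sum>B\<in>\<O>. \<Sum>y\<in>B. ?g y)"
    using sum.Union_disjoint[of \<O> ?g] partition_onD1[OF assms(2)] partition_onD2[OF assms(2)]
    by (simp add: disjoint_def)
  also have "\<dots> = (\<Sum>B\<in>\<O>. 1)"
  proof (rule sum.cong[OF refl])
    fix B assume B: "B \<in> \<O>"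
    \<comment> \<open>Non-emptiness matters: an empty member of the partition would contribute 0
      instead of 1.\<close>
    then obtain x where x: "x \<in> B"
      using partition_onD3[OF assms(2)] by fastforce
    have "(\<Sum>y\<in>B. ?g y) = (\<Sum>y\<in>B. \<pi> $ y / (\<Sum>z\<in>B. \<pi> $ z))"
      using block_eq[OF assms(2) B] by simp
    then show "(\<Sum>y\<in>B. ?g y) = 1"
      using block_measure_pos[of \<pi>, OF assms, of x] block_eq[OF assms(2) B x]
      by (simp flip: sum_divide_distrib)
  qed
  finally show ?thesis by simp
qed

text \<open>The entry is the \<pi>-average of K(z,x) over z in the block of y. Extending the
  numerator from the block to all states adds nonnegative terms, and stationarity evaluates the full
  sum as \<pi>(x).\<close>

lemma gibbs_mult_le:
  assumes "\<And>x. \<pi> $ x > 0" "partition_on UNIV \<O>" "K \<in> stationary_kernels \<pi>"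
  shows "(gibbs \<pi> \<O> ** K) $ y $ x \<le> \<pi> $ x / (\<Sum>z\<in>block \<O> y. \<pi> $ z)"
proof -
  let ?b = "\<Sum>z\<in>block \<O> y. \<pi> $ z"
  have "(gibbs \<pi> \<O> ** K) $ y $ x = (\<Sum>z\<in>UNIV. if z \<in> block \<O> y then \<pi> $ z * K $ z $ x / ?b else 0)"
    unfolding matrix_matrix_mult_def gibbs_def by (auto intro!: sum.cong)
  also have "\<dots> = (\<Sum>z\<in>block \<O> y. \<pi> $ z * K $ z $ x) / ?b"
    by (simp add: sum_divide_distrib flip: sum.inter_restrict)
  also have "\<dots> \<le> (\<Sum>z\<in>UNIV. \<pi> $ z * K $ z $ x) / ?b"
    using assms block_measure_pos[of \<pi> \<O> y]
    by (intro divide_right_mono sum_mono2) (simp_all add: stationary_kernelsD(1) less_imp_le)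
  finally show ?thesis
    using assms(3) by (simp add: stationary_kernelsD(3))
qed

lemma frobenius_norm_gibbs_mult_le:
  assumes "positive_prob \<pi>" "partition_on UNIV \<O>" "K \<in> stationary_kernels \<pi>"
  shows "(frobenius_norm \<pi> (gibbs \<pi> \<O> ** K - stationary_matrix \<pi>))\<^sup>2 \<le> real (card \<O>) - 1"
proof -
  have pos: "\<pi> $ x > 0" for x
    using assms(1) by (simp add: positive_prob_def)
  let ?M = "gibbs \<pi> \<O> ** K" and ?b = "\<lambda>y. \<Sum>z\<in>block \<O> y. \<pi> $ z"
  have M: "?M \<in> stationary_kernels \<pi>"
    using assms by (simp add: stationary_kernels_mult gibbs_stationary)
  have "(\<Sum>y\<in>UNIV. \<Sum>x\<in>UNIV. \<pi> $ y / \<pi> $ x * (?M $ y $ x)\<^sup>2)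
      \<le> (\<Sum>y\<in>UNIV. \<Sum>x\<in>UNIV. \<pi> $ y / ?b y * ?M $ y $ x)"
  proof (intro sum_mono)
    fix x y
    \<comment> \<open>Only one factor of the square is bounded: its bound cancels \<pi>(x), and the
      other factor stays linear so that it sums to 1 along the row.\<close>
    have "\<pi> $ y / \<pi> $ x * (?M $ y $ x)\<^sup>2 = (\<pi> $ y / \<pi> $ x * ?M $ y $ x) * ?M $ y $ x"
      by (simp add: power2_eq_square)
    also have "\<dots> \<le> (\<pi> $ y / \<pi> $ x * ?M $ y $ x) * (\<pi> $ x / ?b y)"
      using gibbs_mult_le[of \<pi>, OF pos assms(2,3), of y x] pos stationary_kernelsD(1)[OF M]
      by (intro mult_left_mono) (simp_all add: less_imp_le)
    also have "\<dots> = \<pi> $ y / ?b y * ?M $ y $ x"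
      using pos[of x] by simp
    finally show "\<pi> $ y / \<pi> $ x * (?M $ y $ x)\<^sup>2 \<le> \<pi> $ y / ?b y * ?M $ y $ x" .
  qed
  also have "\<dots> = real (card \<O>)"
    using sum_divide_block_measure[of \<pi>, OF pos assms(2)] stationary_kernelsD(2)[OF M]
    by (simp only: mult_1_right flip: sum_distrib_left)
  finally show ?thesis
    by (simp add: frobenius_norm_diff_stationary_matrix[OF assms(1) M])
qed

lemma frobenius_norm_lazy_ge:
  fixes \<pi> :: "real ^ 'n"
  assumes "positive_prob \<pi>" "P \<in> stationary_kernels \<pi>" "lazy P"
  shows "(frobenius_norm \<pi> (P - stationary_matrix \<pi>))\<^sup>2 \<ge> real CARD('n) / 4 - 1"
proof -
  have pos: "\<pi> $ x > 0" for x
    using assms(1) by (simp add: positive_prob_def)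
  have "real CARD('n) / 4 = (\<Sum>y\<in>(UNIV::'n set). (1 / 2)\<^sup>2)"
    by (simp add: power2_eq_square)
  also have "\<dots> \<le> (\<Sum>y\<in>UNIV. \<Sum>x\<in>UNIV. \<pi> $ y / \<pi> $ x * (P $ y $ x)\<^sup>2)"
  proof (rule sum_mono)
    fix y
    have "(1 / 2)\<^sup>2 \<le> (P $ y $ y)\<^sup>2"
      using assms(3) by (intro power_mono) (simp_all add: lazy_def)
    \<comment> \<open>The weight is 1 on the diagonal, so each state contributes at least 1/4
      whatever \<pi> is.\<close>
    also have "\<dots> = \<pi> $ y / \<pi> $ y * (P $ y $ y)\<^sup>2"
      using pos[of y] by simp
    also have "\<dots> \<le> (\<Sum>x\<in>UNIV. \<pi> $ y / \<pi> $ x * (P $ y $ x)\<^sup>2)"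
      using pos by (intro member_le_sum) (simp_all add: less_imp_le)
    finally show "(1 / 2)\<^sup>2 \<le> (\<Sum>x\<in>UNIV. \<pi> $ y / \<pi> $ x * (P $ y $ x)\<^sup>2)" .
  qed
  finally show ?thesis
    by (simp add: frobenius_norm_diff_stationary_matrix[OF assms(1,2)])
qed

text \<open>Since \<pi> and the partition are fixed, the order claims are stated for the explicit
  bounds as sequences in fresh variables \<open>j\<close> and \<open>m\<close>.\<close>

theorem proposition5p1:
  fixes \<pi> :: "real ^ 'n" and \<O> :: "'n set set" and k :: nat
  assumes "positive_prob \<pi>"
    and "partition_on UNIV \<O>"
    and "card \<O> = k"
  shows
    "(\<forall>P \<in> reversible_kernels \<pi>.
        (frobenius_norm \<pi> (gibbs \<pi> \<O> ** P - stationary_matrix \<pi>))\<^sup>2 \<le> real k - 1 \<and>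
        (frobenius_norm \<pi> (gibbs \<pi> \<O> ** P ** gibbs \<pi> \<O> - stationary_matrix \<pi>))\<^sup>2 \<le> real k - 1)
     \<and> (\<lambda>j::nat. real j - 1) \<in> O(\<lambda>j. real j)
     \<and> (k = 2 \<longrightarrow> (\<forall>P \<in> reversible_kernels \<pi>.
        (frobenius_norm \<pi> (gibbs \<pi> \<O> ** P - stationary_matrix \<pi>))\<^sup>2 \<le> 1 \<and>
        (frobenius_norm \<pi> (gibbs \<pi> \<O> ** P ** gibbs \<pi> \<O> - stationary_matrix \<pi>))\<^sup>2 \<le> 1))
     \<and> (\<lambda>m::nat. 1 :: real) \<in> O(\<lambda>m. 1)
     \<and> (\<forall>P \<in> stationary_kernels \<pi>. lazy P \<longrightarrow>
        (frobenius_norm \<pi> (P - stationary_matrix \<pi>))\<^sup>2 \<ge> real CARD('n) / 4 - 1)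
     \<and> (\<lambda>m::nat. real m / 4 - 1) \<in> \<Omega>(\<lambda>m. real m)"
proof (intro conjI ballI impI)
  have GP: "(frobenius_norm \<pi> (gibbs \<pi> \<O> ** P - stationary_matrix \<pi>))\<^sup>2 \<le> real k - 1"
    and GPG: "(frobenius_norm \<pi> (gibbs \<pi> \<O> ** P ** gibbs \<pi> \<O> - stationary_matrix \<pi>))\<^sup>2 \<le> real k - 1"
    if "P \<in> reversible_kernels \<pi>" for P
  proof -
    have P: "P \<in> stationary_kernels \<pi>"
      using that by (simp add: reversible_kernels_def)
    \<comment> \<open>By associativity GPG is G(PG), so the general bound applies with K =
      PG.\<close>
    then have "P ** gibbs \<pi> \<O> \<in> stationary_kernels \<pi>"
      using assms by (simp add: stationary_kernels_mult gibbs_stationary)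
    with P show "(frobenius_norm \<pi> (gibbs \<pi> \<O> ** P - stationary_matrix \<pi>))\<^sup>2 \<le> real k - 1"
      "(frobenius_norm \<pi> (gibbs \<pi> \<O> ** P ** gibbs \<pi> \<O> - stationary_matrix \<pi>))\<^sup>2 \<le> real k - 1"
      using frobenius_norm_gibbs_mult_le[OF assms(1,2)] assms(3)
      by (simp_all flip: matrix_mul_assoc)
  qed
  fix P assume P: "P \<in> reversible_kernels \<pi>"
  show "(frobenius_norm \<pi> (gibbs \<pi> \<O> ** P - stationary_matrix \<pi>))\<^sup>2 \<le> real k - 1"
    "(frobenius_norm \<pi> (gibbs \<pi> \<O> ** P ** gibbs \<pi> \<O> - stationary_matrix \<pi>))\<^sup>2 \<le> real k - 1"
    using P by (fact GP, fact GPG)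
  assume "k = 2"
  then show "(frobenius_norm \<pi> (gibbs \<pi> \<O> ** P - stationary_matrix \<pi>))\<^sup>2 \<le> 1"
    "(frobenius_norm \<pi> (gibbs \<pi> \<O> ** P ** gibbs \<pi> \<O> - stationary_matrix \<pi>))\<^sup>2 \<le> 1"
    using GP[OF P] GPG[OF P] by simp_all
next
  show "(\<lambda>j::nat. real j - 1) \<in> O(\<lambda>j. real j)"
    by real_asymp
  show "(\<lambda>m::nat. 1 :: real) \<in> O(\<lambda>m. 1)"
    by simp
  \<comment> \<open>For instance, m/4 - 1 is at least m/8 as soon as m is at least 8.\<close>
  show "(\<lambda>m::nat. real m / 4 - 1) \<in> \<Omega>(\<lambda>m. real m)"
    by real_asymp
next
  fix P assume "P \<in> stationary_kernels \<pi>" "lazy P"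
  then show "(frobenius_norm \<pi> (P - stationary_matrix \<pi>))\<^sup>2 \<ge> real CARD('n) / 4 - 1"
    by (rule frobenius_norm_lazy_ge[OF assms(1)])
qed

end
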